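(* For every $a>0$, $k\in\mathbb Z_+$ and $x\in\mathbb R$, the Hermite polynomials $H_n^a$ and Charlier polynomials $C_n^a$ satisfy $$\sum_{n=0}^\infty\frac{H_n^a(x)\,C_n^a(k)}{a^n\,n!}=e^{-\frac a2-x}\,\frac{H_k^a(x+2a)}{a^k}.$$ In particular, denoting $C_n=C_n^1$ and $H_n=H_n^1$, $$\sum_{n=0}^\infty\frac{H_n(x)\,C_n(k)}{n!}=e^{-\frac12-x}H_k(x+2).$$
   Context: Hermite polynomials: $H_n(x)=(-1)^ne^{x^2/2}\frac{d^n}{dx^n}e^{-x^2/2}$, $H_n^a(x)=a^{n/2}H_n(x/\sqrt a)$, so that $\sum_{n\ge0}H_n^a(x)\frac{t^n}{n!}=e^{tx-\frac{t^2a}2}$. Charlier polynomials: $C_n^a(x)=a^n\sum_{j=0}^n(-1)^{n-j}\binom nj a^{-j}\binom xj j!$, so that $\sum_{n\ge0}C_n^a(y)\frac{t^n}{n!}=(1+t)^ye^{-ta}$. *)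

theory Defs
  imports "HOL-Analysis.Analysis"
begin

definition hermite :: "nat \<Rightarrow> real \<Rightarrow> real" where
  "hermite n x =
     (-1) ^ n * exp (x\<^sup>2 / 2) * (deriv ^^ n) (\<lambda>t. exp (- (t\<^sup>2 / 2))) x"

(* Meant for a > 0: only there is a powr (n / 2) the intended real power. *)
definition hermite_scaled :: "real \<Rightarrow> nat \<Rightarrow> real \<Rightarrow> real" where
  "hermite_scaled a n x = a powr (real n / 2) * hermite n (x / sqrt a)"

definition charlier :: "real \<Rightarrow> nat \<Rightarrow> real \<Rightarrow> real" where
  "charlier a n x =
     a ^ n * (\<Sum>j=0..n. (-1) ^ (n - j) * real (n choose j) * inverse (a ^ j) * (x gchoose j) * fact j)"

lemma hermite_scaled_one: "hermite_scaled 1 n x = hermite n x"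
  by (simp add: hermite_scaled_def)

end

theory Submission
  imports Defs
begin

unbundle no vec_syntax and fps_syntax

text \<open>
  Write \<open>S\<^sub>k\<close> for the sum of the series. The recurrences
  \<open>C\<^sub>n(k+1) = C\<^sub>n(k) + n C\<^sub>n\<^sub>-\<^sub>1(k)\<close>, \<open>C\<^sub>n\<^sub>+\<^sub>1(k) = k C\<^sub>n(k-1) - a C\<^sub>n(k)\<close> and
  \<open>H\<^sub>n\<^sub>+\<^sub>1 = x H\<^sub>n - a n H\<^sub>n\<^sub>-\<^sub>1\<close> give, after shifting indices,
  \<open>a S\<^sub>k\<^sub>+\<^sub>1 = (x + 2a) S\<^sub>k - k S\<^sub>k\<^sub>-\<^sub>1\<close>, which is the recurrence of \<open>H\<^sub>k(x + 2a) / a\<^sup>k\<close>.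
  The initial value \<open>S\<^sub>0\<close> is the Hermite generating function at \<open>t = -1\<close>.
\<close>

section \<open>Derivatives of the Gaussian and the Hermite recurrence\<close>

text \<open>Differentiating \<open>f' = - t f\<close> repeatedly gives this by the Leibniz rule.
  Since \<open>deriv\<close> alone does not certify differentiability, the induction carries
  existence of the derivative along with its value.\<close>

lemma gaussian_deriv_rec:
  defines "f \<equiv> \<lambda>t::real. exp (- (t\<^sup>2 / 2))"
  shows "((deriv ^^ n) f has_real_derivative
           - t * (deriv ^^ n) f t - real n * (deriv ^^ (n - 1)) f t) (at t)"
proof (induction n arbitrary: t rule: less_induct)
  case (less n)
  show ?case
  proof (cases n)
    case 0
    then show ?thesis unfolding f_def by (auto intro!: derivative_eq_intros)
  next
    case (Suc m)
    have D: "((deriv ^^ i) f has_real_derivative (deriv ^^ Suc i) f t) (at t)" if "i < n" for i t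
      using less[OF that, of t] by (simp add: DERIV_imp_deriv)
    have step: "(deriv ^^ n) f = (\<lambda>t. - t * (deriv ^^ m) f t - real m * (deriv ^^ (m - 1)) f t)"
      using Suc less[of m] by (auto simp: fun_eq_iff intro!: DERIV_imp_deriv)
    \<comment> \<open>For \<open>m = 0\<close> the index \<open>m - 1\<close> truncates, but both
      sides then carry the factor zero.\<close>
    have m1: "((\<lambda>t. real m * (deriv ^^ (m - 1)) f t) has_real_derivative
                real m * (deriv ^^ m) f t) (at t)"
      using DERIV_cmult[OF D[of "m - 1" t], of "real m"] Suc by (cases m) simp_all
    have "m < n" using Suc by simp
    have "((\<lambda>t. - t * (deriv ^^ m) f t - real m * (deriv ^^ (m - 1)) f t) has_real_derivative
            - 1 * (deriv ^^ m) f t + (deriv ^^ Suc m) f t * - t - real m * (deriv ^^ m) f t) (at t)"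
      by (rule DERIV_diff[OF DERIV_mult[OF DERIV_minus[OF DERIV_ident] D[OF \<open>m < n\<close>]] m1])
    hence "((deriv ^^ n) f has_real_derivative
            - 1 * (deriv ^^ m) f t + (deriv ^^ n) f t * - t - real m * (deriv ^^ m) f t) (at t)"
      by (simp only: step[symmetric] Suc[symmetric])
    moreover have "- 1 * (deriv ^^ m) f t + (deriv ^^ n) f t * - t - real m * (deriv ^^ m) f t =
        - t * (deriv ^^ n) f t - real n * (deriv ^^ (n - 1)) f t"
      using Suc by (simp del: funpow.simps add: distrib_right)
    ultimately show ?thesis by (simp only:)
  qed
qed

lemma hermite_0: "hermite 0 x = 1"
  by (simp add: hermite_def flip: exp_add)

text \<open>At \<open>n = 0\<close> the term with the truncated index \<open>n - 1\<close> has coefficient zero.\<close>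

lemma hermite_Suc: "hermite (Suc n) x = x * hermite n x - real n * hermite (n - 1) x"
proof -
  define d where "d = (\<lambda>k. (deriv ^^ k) (\<lambda>t. exp (- (t\<^sup>2 / 2))) x)"
  have hd: "hermite k x = (- 1) ^ k * exp (x\<^sup>2 / 2) * d k" for k
    by (simp add: hermite_def d_def)
  have dS: "d (Suc n) = - x * d n - real n * d (n - 1)"
    using DERIV_imp_deriv[OF gaussian_deriv_rec[of n x]] by (simp add: d_def)
  show ?thesis unfolding hd dS by (cases n) (simp_all add: algebra_simps)
qed

lemma hermite_scaled_0: "a > 0 \<Longrightarrow> hermite_scaled a 0 x = 1"
  by (simp add: hermite_scaled_def hermite_0)

lemma hermite_scaled_sqrt: "a > 0 \<Longrightarrow> hermite_scaled a n x = sqrt a ^ n * hermite n (x / sqrt a)"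
  by (simp add: hermite_scaled_def powr_half_sqrt_powr powr_realpow real_sqrt_power)

lemma hermite_scaled_Suc:
  assumes "a > 0"
  shows "hermite_scaled a (Suc n) x =
           x * hermite_scaled a n x - a * real n * hermite_scaled a (n - 1) x"
proof -
  \<comment> \<open>With \<open>s = sqrt a\<close> the factor \<open>a\<close> of the claim is
    \<open>s ^ 2\<close>, the ratio of the weights at \<open>Suc n\<close> and \<open>n - 1\<close>
    when \<open>n > 0\<close>.\<close>
  define s where "s = sqrt a"
  have s: "a = s\<^sup>2" "s \<noteq> 0" using assms by (simp_all add: s_def)
  have "s ^ Suc n * hermite (Suc n) (x / s) =
      x * (s ^ n * hermite n (x / s)) - s\<^sup>2 * real n * (s ^ (n - 1) * hermite (n - 1) (x / s))"
    using s(2) by (cases n) (simp_all add: hermite_Suc field_simps power2_eq_square)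
  thus ?thesis
    unfolding hermite_scaled_sqrt[OF assms] s_def[symmetric] by (simp only: s(1))
qed

section \<open>Generating function of the Hermite polynomials\<close>

text \<open>The Taylor series of \<open>exp (- (t^2 / 2))\<close> at the origin.\<close>

definition gaussian_fps :: "real fps" where
  "gaussian_fps = Abs_fps (\<lambda>n. if even n then (- 1 / 2) ^ (n div 2) / fact (n div 2) else 0)"

lemma fps_deriv_gaussian: "fps_deriv gaussian_fps = - fps_X * gaussian_fps"
proof (rule fps_ext)
  fix n
  show "fps_deriv gaussian_fps $ n = (- fps_X * gaussian_fps) $ n"
  proof (cases n)
    case (Suc m)
    have coeff: "2 * real (Suc i) * (- 1 / 2 * y / (real (Suc i) * fact i)) = - (y / fact i)" for i y
      by (simp add: field_simps del: of_nat_Suc)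
    have "real (Suc (Suc m)) * ((- 1 / 2) ^ Suc (m div 2) / fact (Suc (m div 2))) =
        - ((- 1 / 2) ^ (m div 2) / fact (m div 2))" if "even m"
    proof -
      have "real (Suc (Suc m)) = 2 * real (Suc (m div 2))" using that by (elim evenE) simp
      thus ?thesis using coeff[of "m div 2" "(- 1 / 2) ^ (m div 2)"]
        by (simp only: power_Suc fact_Suc)
    qed
    with Suc show ?thesis
      by (simp add: gaussian_fps_def mult.assoc)
  qed (simp add: gaussian_fps_def)
qed

text \<open>The product \<open>F\<close> satisfies \<open>F' = (x - X) F\<close> with constant term
  1; comparing coefficients turns this into the Hermite recurrence.\<close>

lemma fps_nth_hermite: "(fps_exp x * gaussian_fps) $ n = hermite n x / fact n"
proof -
  define F where "F = fps_exp x * gaussian_fps"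
  have "fps_deriv F = fps_const x * F - fps_X * F"
    by (simp add: F_def fps_deriv_gaussian algebra_simps)
  hence rec: "real (Suc n) * F $ Suc n = x * F $ n - (if n = 0 then 0 else F $ (n - 1))" for n
  proof -
    have "real (Suc n) * F $ Suc n = fps_deriv F $ n" by simp
    also have "\<dots> = x * F $ n - (if n = 0 then 0 else F $ (n - 1))"
      unfolding \<open>fps_deriv F = _\<close> by simp
    finally show ?thesis .
  qed
  have "F $ n = hermite n x / fact n"
  proof (induction n rule: less_induct)
    case (less n)
    show ?case
    proof (cases n)
      case 0
      then show ?thesis by (simp add: F_def gaussian_fps_def hermite_0)
    next
      case (Suc m)
      have F: "F $ m = hermite m x / fact m" "F $ (m - 1) = hermite (m - 1) x / fact (m - 1)"
        using less Suc by simp_all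
      have "F $ Suc m = (x * F $ m - (if m = 0 then 0 else F $ (m - 1))) / real (Suc m)"
        using rec[of m] by (simp add: field_simps)
      also have "\<dots> = (x * hermite m x - real m * hermite (m - 1) x) / fact (Suc m)"
        unfolding F by (cases m) (simp_all add: field_simps del: of_nat_Suc)
      also have "\<dots> = hermite (Suc m) x / fact (Suc m)" by (simp only: hermite_Suc[of m])
      finally show ?thesis using Suc by simp
    qed
  qed
  thus ?thesis by (simp add: F_def)
qed

text \<open>Odd terms vanish, and the even ones form the exponential series at
  \<open>- (t^2 / 2)\<close>. Absolute convergence is recorded for the Cauchy product below.\<close>

lemma gaussian_fps_sums:
  "(\<lambda>n. gaussian_fps $ n * t ^ n) sums exp (- (t\<^sup>2 / 2))"
  "summable (\<lambda>n. norm (gaussian_fps $ n * t ^ n))"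
proof -
  have sm: "strict_mono (\<lambda>n::nat. 2 * n)" by (simp add: strict_mono_def)
  have 0: "gaussian_fps $ n = 0" if "n \<notin> range (\<lambda>n. 2 * n)" for n
    using that by (auto simp: gaussian_fps_def)
  have eq: "gaussian_fps $ (2 * n) * t ^ (2 * n) = (- (t\<^sup>2 / 2)) ^ n /\<^sub>R fact n" for n
  proof -
    have "(- 1 / 2) ^ n * (t ^ 2) ^ n = (- (t\<^sup>2 / 2)) ^ n"
      by (simp flip: power_mult_distrib)
    thus ?thesis by (simp add: gaussian_fps_def power_mult divide_simps)
  qed
  show "(\<lambda>n. gaussian_fps $ n * t ^ n) sums exp (- (t\<^sup>2 / 2))"
    by (subst sums_mono_reindex[OF sm, symmetric])
      (auto simp: 0 eq simp del: scaleR_conv_of_real real_scaleR_def intro: exp_converges)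
  show "summable (\<lambda>n. norm (gaussian_fps $ n * t ^ n))"
    by (subst summable_mono_reindex[OF sm, symmetric])
      (use summable_norm_exp[of "- (t\<^sup>2 / 2)"] in \<open>auto simp: 0 eq simp del: norm_scaleR real_scaleR_def\<close>)
qed

text \<open>The formal identity becomes analytic through the Cauchy product of two absolutely
  convergent series.\<close>

lemma hermite_egf: "(\<lambda>n. hermite n x * t ^ n / fact n) sums exp (t * x - t\<^sup>2 / 2)"
proof -
  let ?f = "\<lambda>n. fps_exp x $ n * t ^ n" and ?g = "\<lambda>n. gaussian_fps $ n * t ^ n"
  have f: "?f n = (t * x) ^ n /\<^sub>R fact n" for n
    by (simp add: field_simps power_mult_distrib)
  have "?f sums exp (t * x)" "summable (\<lambda>n. norm (?f n))"
    by (simp_all only: f exp_converges summable_norm_exp)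
  hence "(\<lambda>n. \<Sum>i\<le>n. ?f i * ?g (n - i)) sums (exp (t * x) * exp (- (t\<^sup>2 / 2)))"
    using Cauchy_product_sums[of ?f ?g] gaussian_fps_sums[of t] by (simp add: sums_iff)
  moreover have "(\<Sum>i\<le>n. ?f i * ?g (n - i)) = hermite n x * t ^ n / fact n" for n
  proof -
    have "(\<Sum>i\<le>n. ?f i * ?g (n - i)) = (\<Sum>i\<le>n. (fps_exp x $ i * gaussian_fps $ (n - i)) * t ^ n)"
    proof (rule sum.cong)
      fix i assume "i \<in> {..n}"
      hence "t ^ n = t ^ i * t ^ (n - i)" by (simp flip: power_add)
      thus "?f i * ?g (n - i) = (fps_exp x $ i * gaussian_fps $ (n - i)) * t ^ n" by simp
    qed simp
    also have "\<dots> = (fps_exp x * gaussian_fps) $ n * t ^ n"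
      by (simp only: fps_mult_nth atLeast0AtMost sum_distrib_right)
    finally show ?thesis by (simp add: fps_nth_hermite del: fps_exp_nth)
  qed
  ultimately show ?thesis by (simp flip: exp_add)
qed

lemma hermite_scaled_egf:
  assumes "a > 0"
  shows "(\<lambda>n. hermite_scaled a n x * t ^ n / fact n) sums exp (t * x - t\<^sup>2 * a / 2)"
  using hermite_egf[of "x / sqrt a" "t * sqrt a"] assms
  by (simp add: hermite_scaled_sqrt power_mult_distrib mult_ac)

section \<open>Charlier polynomials at natural arguments\<close>

definition charlier_fps :: "real \<Rightarrow> nat \<Rightarrow> real fps" where
  "charlier_fps a k = (1 + fps_X) ^ k * fps_exp (- a)"

text \<open>The coefficient is a convolution of binomial and exponential coefficients;
  \<open>a ^ n * inverse (a ^ j)\<close> becomes \<open>a ^ (n - j)\<close>.\<close>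

lemma charlier_eq_fps_nth:
  assumes "a \<noteq> 0"
  shows "charlier a n (real k) = fact n * charlier_fps a k $ n"
proof -
  have "charlier_fps a k $ n = (\<Sum>j=0..n. real (k choose j) * ((- a) ^ (n - j) / fact (n - j)))"
    by (simp add: charlier_fps_def fps_mult_nth flip: fps_binomial_of_nat binomial_gbinomial)
  also have "\<dots> = charlier a n (real k) / fact n"
    unfolding charlier_def sum_distrib_left sum_divide_distrib
  proof (rule sum.cong)
    fix j assume "j \<in> {0..n}"
    hence j: "j \<le> n" by simp
    have "a ^ n = a ^ j * a ^ (n - j)" using j by (simp flip: power_add)
    moreover have "(- a) ^ (n - j) = (- 1) ^ (n - j) * a ^ (n - j)"
      by (simp flip: power_mult_distrib)
    ultimately show "real (k choose j) * ((- a) ^ (n - j) / fact (n - j)) =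
        a ^ n * ((- 1) ^ (n - j) * real (n choose j) * inverse (a ^ j) * (real k gchoose j) * fact j)
          / fact n"
      using j assms by (simp add: binomial_fact binomial_gbinomial[symmetric] field_simps)
  qed simp
  finally show ?thesis by simp
qed

lemma charlier_at_0: "a \<noteq> 0 \<Longrightarrow> charlier a n 0 = (- a) ^ n"
  using charlier_eq_fps_nth[of a n 0] by (simp add: charlier_fps_def)

text \<open>Raising \<open>k\<close> by one multiplies the generating function by
  \<open>1 + X\<close>.\<close>

lemma charlier_Suc_arg:
  assumes "a \<noteq> 0"
  shows "charlier a n (real (Suc k)) = charlier a n (real k) + real n * charlier a (n - 1) (real k)"
proof -
  have "charlier_fps a (Suc k) = charlier_fps a k + fps_X * charlier_fps a k"
    by (simp add: charlier_fps_def algebra_simps)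
  thus ?thesis
    unfolding charlier_eq_fps_nth[OF assms] by (cases n) (simp_all add: algebra_simps)
qed

text \<open>Differentiating the generating function shifts its coefficients; the product rule gives
  the two terms on the right.\<close>

lemma charlier_Suc_index:
  assumes "a \<noteq> 0"
  shows "charlier a (Suc n) (real k) = real k * charlier a n (real (k - 1)) - a * charlier a n (real k)"
proof -
  have "fps_deriv (charlier_fps a k) =
      fps_const (real k) * charlier_fps a (k - 1) - fps_const a * charlier_fps a k"
    by (simp add: charlier_fps_def fps_deriv_power algebra_simps flip: fps_const_neg)
  hence "real (Suc n) * charlier_fps a k $ Suc n =
      real k * charlier_fps a (k - 1) $ n - a * charlier_fps a k $ n"
    by (metis Suc_eq_plus1 fps_deriv_nth fps_mult_left_const_nth fps_sub_nth)
  hence "fact n * (real (Suc n) * charlier_fps a k $ Suc n) =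
      fact n * (real k * charlier_fps a (k - 1) $ n - a * charlier_fps a k $ n)"
    by simp
  thus ?thesis
    unfolding charlier_eq_fps_nth[OF assms] by (simp add: algebra_simps)
qed

section \<open>Summation of the mixed series by induction on \<open>k\<close>\<close>

lemma hermite_charlier_sums:
  assumes "a > 0"
  shows "(\<lambda>n. hermite_scaled a n x * charlier a n (real k) / (a ^ n * fact n))
           sums (exp (- a / 2 - x) * (hermite_scaled a k (x + 2 * a) / a ^ k))"
proof -
  define h where "h = (\<lambda>n. hermite_scaled a n x)"
  define c where "c = (\<lambda>k n. charlier a n (real k))"
  define w where "w = (\<lambda>n. a ^ n * fact n :: real)"
  define R where "R = (\<lambda>k. exp (- a / 2 - x) * (hermite_scaled a k (x + 2 * a) / a ^ k))"
  have a: "a \<noteq> 0" using assms by simp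
  have w0: "w n \<noteq> 0" and wS: "w (Suc n) = a * real (Suc n) * w n" for n
    using a by (simp_all add: w_def)
  have hS: "h (Suc n) = x * h n - a * real n * h (n - 1)" for n
    using hermite_scaled_Suc[OF assms] by (simp add: h_def)
  have cS: "c (Suc k) n = c k n + real n * c k (n - 1)"
    and cI: "c k (Suc n) = real k * c (k - 1) n - a * c k n" for k n
    using charlier_Suc_arg[OF a] charlier_Suc_index[OF a] unfolding c_def by blast+
  have RS: "R (Suc k) = ((x + 2 * a) * R k - real k * R (k - 1)) / a" for k
    unfolding R_def hermite_scaled_Suc[OF assms] using a by (cases k) (simp_all add: field_simps)
  have "(\<lambda>n. h n * c k n / w n) sums R k"
  \<comment> \<open>The recurrence reaches back two indices. Each step combines series already known
    to converge, so convergence is obtained together with the value.\<close>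
  proof (induction k rule: less_induct)
    case (less k)
    show ?case
    proof (cases k)
      case 0
      \<comment> \<open>The value \<open>(- a) ^ n\<close> of the Charlier polynomial at 0 cancels
        \<open>a ^ n\<close> in the weight.\<close>
      have "h n * c 0 n / w n = hermite_scaled a n x * (- 1) ^ n / fact n" for n
        using a by (simp add: h_def c_def w_def charlier_at_0 power_minus[of a])
      thus ?thesis
        using hermite_scaled_egf[OF assms, of x "- 1"] 0 assms
        by (simp add: R_def hermite_scaled_0 diff_diff_eq2 minus_diff_commute)
    next
      case (Suc j)
      have Sj: "(\<lambda>n. h n * c j n / w n) sums R j"
        using less Suc by simp
      \<comment> \<open>For \<open>j = 0\<close> the truncated index \<open>j - 1\<close> comes with
        coefficient zero.\<close>
      have Sj1: "(\<lambda>n. real j * (h n * c (j - 1) n / w n)) sums (real j * R (j - 1))"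
        using less[of "j - 1"] Suc by (intro sums_mult) simp
      have "(\<lambda>n. h n * c j (Suc n) / w n) sums (real j * R (j - 1) - a * R j)"
        using sums_diff[OF Sj1 sums_mult[OF Sj, of a]]
        by (simp add: cI diff_divide_distrib algebra_simps)
      \<comment> \<open>The weight ratio \<open>a * real (Suc n)\<close> exhibits this series as a
        shifted one, whose missing term at index 0 vanishes.\<close>
      moreover have "h n * c j (Suc n) / w n = a * real (Suc n) * h n * c j (Suc n) / w (Suc n)" for n
        unfolding wS using a w0[of n] by (simp add: field_simps del: of_nat_Suc)
      ultimately have "(\<lambda>n. a * real n * h (n - 1) * c j n / w n) sums (real j * R (j - 1) - a * R j)"
        using sums_Suc[of "\<lambda>n. a * real n * h (n - 1) * c j n / w n"] by simp
      \<comment> \<open>Subtracting from \<open>x\<close> times the series for \<open>j\<close>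
        assembles \<open>h (Suc n)\<close> by the Hermite recurrence.\<close>
      from sums_diff[OF sums_mult[OF Sj, of x] this]
      have "(\<lambda>n. h (Suc n) * c j n / w n) sums ((x + a) * R j - real j * R (j - 1))"
        by (simp add: hS diff_divide_distrib algebra_simps)
      hence "(\<lambda>n. h (Suc n) * c j n / w n / a) sums (((x + a) * R j - real j * R (j - 1)) / a)"
        by (rule sums_divide)
      \<comment> \<open>A second shift, again with zero initial term, yields the extra summand of
        \<open>cS\<close>.\<close>
      moreover have "h (Suc n) * c j n / w n / a = real (Suc n) * h (Suc n) * c j n / w (Suc n)" for n
        unfolding wS using a w0[of n] by (simp add: field_simps del: of_nat_Suc)
      ultimately have "(\<lambda>n. real n * h n * c j (n - 1) / w n)
          sums (((x + a) * R j - real j * R (j - 1)) / a)"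
        using sums_Suc[of "\<lambda>n. real n * h n * c j (n - 1) / w n"] by simp
      from sums_add[OF Sj this]
      have "(\<lambda>n. h n * c k n / w n) sums (R j + ((x + a) * R j - real j * R (j - 1)) / a)"
        by (simp add: Suc cS add_divide_distrib algebra_simps)
      moreover have "R j + ((x + a) * R j - real j * R (j - 1)) / a = R k"
        using a by (simp add: Suc RS field_simps)
      ultimately show ?thesis by simp
    qed
  qed
  thus ?thesis by (simp add: h_def c_def w_def R_def)
qed

theorem corollary1:
  shows "(\<forall>a>0. \<forall>(k::nat) (x::real).
            (\<lambda>n. hermite_scaled a n x * charlier a n (real k) / (a ^ n * fact n))
              sums (exp (- a / 2 - x) * (hermite_scaled a k (x + 2 * a) / a ^ k)))
       \<and> (\<forall>(k::nat) (x::real).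
            (\<lambda>n. hermite n x * charlier 1 n (real k) / fact n)
              sums (exp (- 1 / 2 - x) * hermite k (x + 2)))"
proof (intro conjI allI impI)
  fix k and x :: real
  show "(\<lambda>n. hermite n x * charlier 1 n (real k) / fact n)
          sums (exp (- 1 / 2 - x) * hermite k (x + 2))"
    using hermite_charlier_sums[of 1 x k] by (simp add: hermite_scaled_one)
qed (rule hermite_charlier_sums)

end
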